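(* Let $n\ge2$ be an integer and $a\ne0$ a real number, with the condition $(-1)^{n/2}a<0$ if $n$ is even. Let $u$ be the solution to the heat-type differential problem $$\begin{cases} \dfrac{\partial u}{\partial t}(t,x)=a\,\dfrac{\partial^nu}{\partial x^n}(t,x),&t\ge0,\ x\in\mathbb{R}, \\ u(0,x)=\delta(x), \\ \lim_{x\to\pm\infty}u(t,x)=0,&\forall\,t. \end{cases}$$ Then, for every fixed $t>0$, the single-variable function $y=u(t,\cdot):\mathbb{R}\to\mathbb{R}$ satisfies the Airy-type equation $$y^{(n-1)}(x)+c\,x\,y(x)=0,\qquad x\in\mathbb{R},\qquad\text{with } c=\frac1{nta}.$$
   Context: $\delta$ is the Dirac delta at $0$. The solution of the problem is the one obtained via the $x$-Fourier transform $\mathcal{F}u(t,\gamma)=\int_{-\infty}^\infty e^{i\gamma x}u(t,x)\,dx$, i.e. $\mathcal{F}u(t,\gamma)=e^{at(-i\gamma)^n}$. Explicitly, for $t>0$: if $n=2m+1$ is odd, $u(t,x)=\frac1\pi\int_0^\infty\cos\bigl(xw+(-1)^m a\,t\,w^{n}\bigr)dw$ (improper integral); if $n=2m$ is even, $u(t,x)=\frac1\pi\int_0^\infty\cos(xw)\,e^{(-1)^m a\,t\,w^{n}}dw$. *)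

theory Defs
  imports "HOL-Analysis.Analysis"
begin

definition times_differentiable :: "nat \<Rightarrow> (real \<Rightarrow> real) \<Rightarrow> bool" where
  "times_differentiable k f \<longleftrightarrow>
     (\<forall>j<k. \<forall>x. (deriv ^^ j) f differentiable (at x))"

definition test_function :: "(real \<Rightarrow> real) \<Rightarrow> bool" where
  "test_function \<phi> \<longleftrightarrow>
     (\<forall>k. times_differentiable k \<phi>) \<and> compact (closure {x. \<phi> x \<noteq> 0})"

(* The problem u_t = a * (d/dx)^n u, u(0,.) = Dirac delta at 0, u(t,x) --> 0 as x --> +-oo.
   As the datum at t = 0 is a distribution, it is attained weakly as t --> 0+, and the
   pointwise conditions are imposed for t > 0 only (no condition on the function u 0). *)
definition heat_type_problem :: "nat \<Rightarrow> real \<Rightarrow> (real \<Rightarrow> real \<Rightarrow> real) \<Rightarrow> bool" where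
  "heat_type_problem n a u \<longleftrightarrow>
     (\<forall>t>0. times_differentiable n (u t)) \<and>
     (\<forall>t>0. \<forall>x. ((\<lambda>s. u s x) has_real_derivative a * (deriv ^^ n) (u t) x) (at t)) \<and>
     (\<forall>\<phi>. test_function \<phi> \<longrightarrow>
        ((\<lambda>t. integral UNIV (\<lambda>x. u t x * \<phi> x)) \<longlongrightarrow> \<phi> 0) (at_right 0)) \<and>
     (\<forall>t>0. (u t \<longlongrightarrow> 0) at_top \<and> (u t \<longlongrightarrow> 0) at_bot)"

(* The transform F u(t,w) = integral of exp (i w x) u(t,x) dx is exp (a t (-i w)^n).
   In the inversion formula u(t,x) = 1/(2 pi) * integral of exp (-i w x) exp (a t (-i w)^n) dw
   the contributions of w and -w are conjugate; the integrand below is their common real part,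
   so u(t,x) = 1/pi times its integral over w >= 0. *)
definition fourier_integrand :: "nat \<Rightarrow> real \<Rightarrow> real \<Rightarrow> real \<Rightarrow> real \<Rightarrow> real" where
  "fourier_integrand n a t x w =
     (if odd n then cos (x * w + (-1) ^ (n div 2) * a * t * w ^ n)
      else cos (x * w) * exp ((-1) ^ (n div 2) * a * t * w ^ n))"

(* The limit R --> oo is essential: for odd n the integral over w >= 0
   converges only conditionally. *)
definition obtained_by_fourier_transform :: "nat \<Rightarrow> real \<Rightarrow> (real \<Rightarrow> real \<Rightarrow> real) \<Rightarrow> bool" where
  "obtained_by_fourier_transform n a u \<longleftrightarrow>
     (\<forall>t>0. \<forall>x.
        ((\<lambda>R. 1 / pi * integral {0..R} (fourier_integrand n a t x)) \<longlongrightarrow> u t x) at_top)"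

end

theory Submission
  imports Defs "HOL-Computational_Algebra.Polynomial"
begin

text \<open>
  Substituting \<open>w = s v\<close> with \<open>s = t powr (-1/n)\<close> in the Fourier integral gives
  \<open>u(t,x) = s u(1, s x)\<close>. Differentiating this in \<open>t\<close> yields \<open>u\<^sub>t = -(x u)\<^sub>x / (n t)\<close>, and comparison
  with \<open>u\<^sub>t = a \<partial>\<^sub>x\<^sup>n u\<close> shows that \<open>\<partial>\<^sub>x\<^sup>n\<^sup>-\<^sup>1 u + c x u\<close> does not depend on \<open>x\<close>; by scaling its value
  is \<open>K / t\<close> with a constant \<open>K\<close>. Multiply by \<open>t \<phi>(x)\<close> for a bump function \<open>\<phi>\<close>, integrate by
  parts and let \<open>t \<rightarrow> 0\<close>: since \<open>u(t,\<cdot>) \<rightarrow> \<delta>\<close> and \<open>x \<phi>(x)\<close> vanishes at \<open>0\<close>, the left side tends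
  to \<open>0\<close>, so \<open>K \<integral>\<phi> = 0\<close> and \<open>K = 0\<close>.
\<close>

section \<open>Iterated differentiability\<close>

lemma times_differentiable_0: "times_differentiable 0 f"
  by (simp add: times_differentiable_def)

text \<open>Peels off the innermost derivative, whereas the definition speaks of
  \<open>(deriv ^^ j) f\<close>. This is the form that inductions on \<open>k\<close> with an
  arbitrary function need.\<close>

lemma times_differentiable_Suc:
  "times_differentiable (Suc k) f \<longleftrightarrow>
     (\<forall>x. f differentiable (at x)) \<and> times_differentiable k (deriv f)"
proof -
  have "(\<forall>j<Suc k. P j) \<longleftrightarrow> P 0 \<and> (\<forall>j<k. P (Suc j))" for P
    by (metis less_Suc_eq_0_disj)
  from this[of "\<lambda>j. \<forall>x. (deriv ^^ j) f differentiable (at x)"] show ?thesis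
    by (simp add: times_differentiable_def funpow_swap1)
qed

lemma times_differentiable_mono:
  "times_differentiable m f \<Longrightarrow> k \<le> m \<Longrightarrow> times_differentiable k f"
  by (auto simp: times_differentiable_def)

lemma differentiable_imp_DERIV_deriv:
  fixes f :: "real \<Rightarrow> real"
  assumes "f differentiable (at x)"
  shows "(f has_real_derivative deriv f x) (at x)"
  using assms by (simp add: DERIV_deriv_iff_real_differentiable)

lemma times_differentiable_has_derivative:
  assumes "times_differentiable n f" "j < n"
  shows "((deriv ^^ j) f has_real_derivative (deriv ^^ Suc j) f x) (at x)"
  using assms differentiable_imp_DERIV_deriv[of "(deriv ^^ j) f" x]
  by (simp add: times_differentiable_def)

lemma times_differentiable_continuous_on:
  assumes "times_differentiable n f" "j < n"
  shows "continuous_on S ((deriv ^^ j) f)"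
  using DERIV_isCont[OF times_differentiable_has_derivative[OF assms]]
  by (intro continuous_at_imp_continuous_on) blast

lemma times_differentiable_add:
  "times_differentiable k f \<Longrightarrow> times_differentiable k g \<Longrightarrow>
     times_differentiable k (\<lambda>x. f x + g x)"
proof (induction k arbitrary: f g)
  case 0
  then show ?case by (simp add: times_differentiable_0)
next
  case (Suc k)
  have d: "((\<lambda>x. f x + g x) has_real_derivative deriv f x + deriv g x) (at x)" for x
    using Suc.prems by (intro derivative_intros differentiable_imp_DERIV_deriv)
      (auto simp: times_differentiable_Suc)
  then have "deriv (\<lambda>x. f x + g x) = (\<lambda>x. deriv f x + deriv g x)"
    by (intro ext DERIV_imp_deriv)
  with d Suc show ?case
    by (auto simp: times_differentiable_Suc real_differentiable_def)
qed

text \<open>By Leibniz the derivative is a sum of two products of \<open>k\<close> times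
  differentiable functions, hence the prior closure under sums.\<close>

lemma times_differentiable_mult:
  "times_differentiable k f \<Longrightarrow> times_differentiable k g \<Longrightarrow>
     times_differentiable k (\<lambda>x. f x * g x)"
proof (induction k arbitrary: f g)
  case 0
  then show ?case by (simp add: times_differentiable_0)
next
  case (Suc k)
  have d: "((\<lambda>x. f x * g x) has_real_derivative deriv f x * g x + f x * deriv g x) (at x)" for x
    using DERIV_mult[OF differentiable_imp_DERIV_deriv differentiable_imp_DERIV_deriv, of f x g]
      Suc.prems by (auto simp: times_differentiable_Suc ac_simps)
  then have "deriv (\<lambda>x. f x * g x) = (\<lambda>x. deriv f x * g x + f x * deriv g x)"
    by (intro ext DERIV_imp_deriv)
  moreover have "times_differentiable k (\<lambda>x. deriv f x * g x + f x * deriv g x)"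
    using Suc.prems times_differentiable_mono[of "Suc k" _ k]
    by (intro times_differentiable_add Suc.IH) (auto simp: times_differentiable_Suc)
  ultimately show ?case
    using d by (auto simp: times_differentiable_Suc real_differentiable_def)
qed

lemma times_differentiable_const: "times_differentiable k (\<lambda>x. c)"
  by (induction k arbitrary: c) (simp_all add: times_differentiable_0 times_differentiable_Suc)

lemma times_differentiable_ident: "times_differentiable k (\<lambda>x. x)"
  by (cases k) (simp_all add: times_differentiable_0 times_differentiable_Suc
      times_differentiable_const)

lemma DERIV_compose_affine:
  fixes f :: "real \<Rightarrow> real"
  assumes "(f has_real_derivative D) (at (s * x + b))"
  shows "((\<lambda>x. f (s * x + b)) has_real_derivative s * D) (at x)"
proof -
  have "((\<lambda>x. s * x + b) has_real_derivative s) (at x)"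
    by (auto intro!: derivative_eq_intros)
  from DERIV_chain2[OF assms this] show ?thesis
    by (simp add: mult.commute)
qed

lemma times_differentiable_compose_affine:
  assumes "times_differentiable k f"
  shows "times_differentiable k (\<lambda>x. f (s * x + b))"
  using assms
proof (induction k arbitrary: f)
  case 0
  then show ?case by (simp add: times_differentiable_0)
next
  case (Suc k)
  have d: "((\<lambda>x. f (s * x + b)) has_real_derivative s * deriv f (s * x + b)) (at x)" for x
    using Suc.prems by (intro DERIV_compose_affine differentiable_imp_DERIV_deriv)
      (auto simp: times_differentiable_Suc)
  then have "deriv (\<lambda>x. f (s * x + b)) = (\<lambda>x. s * deriv f (s * x + b))"
    by (intro ext DERIV_imp_deriv)
  moreover have "times_differentiable k (\<lambda>x. s * deriv f (s * x + b))"
    using Suc by (intro times_differentiable_mult times_differentiable_const)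
      (auto simp: times_differentiable_Suc)
  ultimately show ?case
    using d by (auto simp: times_differentiable_Suc real_differentiable_def)
qed

text \<open>Each differentiation yields one factor \<open>s\<close> by the chain rule; the prefactor
  accounts for the extra one in \<open>Suc j\<close>.\<close>

lemma higher_deriv_scale:
  assumes "times_differentiable n f" "j \<le> n"
  shows "(deriv ^^ j) (\<lambda>x. s * f (s * x)) = (\<lambda>x. s ^ Suc j * (deriv ^^ j) f (s * x))"
  using assms(2)
proof (induction j)
  case (Suc j)
  \<comment> \<open>The \<open>+ 0\<close> only brings the argument into affine form.\<close>
  have "((\<lambda>x. s ^ Suc j * (deriv ^^ j) f (s * x + 0)) has_real_derivative
      s ^ Suc j * (s * (deriv ^^ Suc j) f (s * x + 0))) (at x)" for x
    using Suc.prems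
    by (intro DERIV_cmult DERIV_compose_affine times_differentiable_has_derivative[OF assms(1)]) auto
  then have "deriv (\<lambda>x. s ^ Suc j * (deriv ^^ j) f (s * x)) =
      (\<lambda>x. s ^ Suc j * (s * (deriv ^^ Suc j) f (s * x)))"
    by (intro ext DERIV_imp_deriv) simp
  then show ?case
    using Suc by (simp add: ac_simps)
qed simp

section \<open>Test functions\<close>

text \<open>By Heine-Borel the closure of the support is compact iff the support is bounded.\<close>

lemma test_function_iff:
  "test_function \<phi> \<longleftrightarrow>
     (\<forall>k. times_differentiable k \<phi>) \<and> (\<exists>M. \<forall>x. M < \<bar>x\<bar> \<longrightarrow> \<phi> x = 0)"
proof -
  have "bounded {x. \<phi> x \<noteq> 0} \<longleftrightarrow> (\<exists>M. \<forall>x. M < \<bar>x\<bar> \<longrightarrow> \<phi> x = 0)"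
    by (auto simp: bounded_iff) (meson not_le)+
  then show ?thesis
    by (simp add: test_function_def)
qed

text \<open>The region \<open>M < \<bar>x\<bar>\<close> is open, so \<open>f\<close> agrees with the
  zero function near \<open>x\<close>.\<close>

lemma deriv_zero_outside:
  fixes f :: "real \<Rightarrow> real"
  assumes "\<forall>x. M < \<bar>x\<bar> \<longrightarrow> f x = 0" "M < \<bar>x\<bar>"
  shows "deriv f x = 0"
proof (rule DERIV_imp_deriv, rule has_field_derivative_transform_within_open)
  show "((\<lambda>x. 0) has_real_derivative 0) (at x)"
    by simp
  show "open {x::real. M < \<bar>x\<bar>}"
    by (intro open_Collect_less continuous_intros)
qed (use assms in auto)

lemma test_function_deriv:
  assumes "test_function \<phi>"
  shows "test_function (deriv \<phi>)"
proof -
  obtain M where "\<forall>x. M < \<bar>x\<bar> \<longrightarrow> \<phi> x = 0"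
    using assms by (auto simp: test_function_iff)
  then have "\<forall>x. M < \<bar>x\<bar> \<longrightarrow> deriv \<phi> x = 0"
    using deriv_zero_outside by blast
  moreover have "times_differentiable k (deriv \<phi>)" for k
    using assms times_differentiable_Suc[of k \<phi>] by (auto simp: test_function_iff)
  ultimately show ?thesis
    by (auto simp: test_function_iff)
qed

lemma test_function_funpow_deriv: "test_function \<phi> \<Longrightarrow> test_function ((deriv ^^ k) \<phi>)"
  by (induction k) (auto intro: test_function_deriv)

text \<open>Tests the term \<open>x * u t x\<close> of the equation: the factor \<open>x\<close> is
  moved to the test function, which then vanishes at 0.\<close>

lemma test_function_times_ident:
  assumes "test_function \<phi>"
  shows "test_function (\<lambda>x. x * \<phi> x)"
  using assms by (auto simp: test_function_iff
      intro: times_differentiable_mult times_differentiable_ident)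

lemma test_function_continuous_on: "test_function \<phi> \<Longrightarrow> continuous_on S \<phi>"
  using times_differentiable_continuous_on[of 1 \<phi> 0] by (simp add: test_function_def)

lemma integrable_times_test_function:
  assumes "test_function \<phi>" "continuous_on UNIV f"
  shows "(\<lambda>x. f x * \<phi> x) integrable_on UNIV"
proof -
  obtain M where M: "\<forall>x. M < \<bar>x\<bar> \<longrightarrow> \<phi> x = 0"
    using assms by (auto simp: test_function_iff)
  have "(\<lambda>x. f x * \<phi> x) integrable_on {-M..M}"
    by (intro integrable_continuous_interval continuous_on_mult
        test_function_continuous_on[OF assms(1)] continuous_on_subset[OF assms(2)]) simp
  then show ?thesis
    by (rule integrable_on_superset) (use M in force)+
qed

lemma integral_by_parts_test_function:
  assumes \<phi>: "test_function \<phi>"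
    and f: "\<And>x. (f has_real_derivative f' x) (at x)" and cont: "continuous_on UNIV f'"
  shows "integral UNIV (\<lambda>x. f' x * \<phi> x) = - integral UNIV (\<lambda>x. f x * deriv \<phi> x)"
proof -
  obtain M0 where "\<forall>x. M0 < \<bar>x\<bar> \<longrightarrow> \<phi> x = 0"
    using \<phi> by (auto simp: test_function_iff)
  then obtain M where M: "\<forall>x. M < \<bar>x\<bar> \<longrightarrow> \<phi> x = 0" and "M \<ge> 0"
    by (meson max.strict_boundedE max.cobounded2)
  have d\<phi>: "(\<phi> has_real_derivative deriv \<phi> x) (at x)" for x
    using \<phi> by (intro differentiable_imp_DERIV_deriv)
      (metis test_function_def times_differentiable_Suc)
  have "((\<lambda>x. f x * \<phi> x) has_real_derivative f' x * \<phi> x + f x * deriv \<phi> x) (at x)" for x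
    using DERIV_mult[OF f d\<phi>, of x] by (simp add: ac_simps)
  then have "((\<lambda>x. f' x * \<phi> x + f x * deriv \<phi> x) has_integral
      f (M+1) * \<phi> (M+1) - f (-(M+1)) * \<phi> (-(M+1))) {-(M+1)..M+1}"
    using \<open>M \<ge> 0\<close> by (intro fundamental_theorem_of_calculus)
      (auto simp: has_real_derivative_iff_has_vector_derivative[symmetric]
        intro: has_field_derivative_at_within)
  then have "((\<lambda>x. f' x * \<phi> x + f x * deriv \<phi> x) has_integral 0) {-(M+1)..M+1}"
    using M \<open>M \<ge> 0\<close> by simp
  then have "((\<lambda>x. f' x * \<phi> x + f x * deriv \<phi> x) has_integral 0) UNIV"
    by (rule has_integral_on_superset) (use M deriv_zero_outside[OF M] in force)+
  moreover have "(\<lambda>x. f' x * \<phi> x) integrable_on UNIV"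
    using \<phi> cont by (rule integrable_times_test_function)
  moreover have "(\<lambda>x. f x * deriv \<phi> x) integrable_on UNIV"
    by (rule integrable_times_test_function[OF test_function_deriv[OF \<phi>]])
      (intro continuous_at_imp_continuous_on ballI DERIV_isCont[OF f])
  ultimately show ?thesis
    by (simp add: integral_add integral_unique eq_neg_iff_add_eq_0 flip: integral_add)
qed

text \<open>Integration by parts \<open>k\<close> times, each giving a sign. Order
  \<open>Suc k\<close> makes the \<open>k\<close>-th derivative of \<open>f\<close> differentiable,
  hence continuous.\<close>

lemma integral_higher_deriv_test_function:
  assumes "times_differentiable (Suc k) f" "test_function \<phi>"
  shows "integral UNIV (\<lambda>x. (deriv ^^ k) f x * \<phi> x) =
         (-1) ^ k * integral UNIV (\<lambda>x. f x * (deriv ^^ k) \<phi> x)"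
  using assms
proof (induction k arbitrary: \<phi>)
  case (Suc k)
  have "integral UNIV (\<lambda>x. (deriv ^^ Suc k) f x * \<phi> x) =
      - integral UNIV (\<lambda>x. (deriv ^^ k) f x * deriv \<phi> x)"
    using Suc.prems by (intro integral_by_parts_test_function
        times_differentiable_has_derivative times_differentiable_continuous_on) auto
  also have "\<dots> = - ((-1) ^ k * integral UNIV (\<lambda>x. f x * (deriv ^^ k) (deriv \<phi>) x))"
    using Suc.prems by (subst Suc.IH)
      (auto intro: times_differentiable_mono test_function_deriv)
  finally show ?case
    by (simp add: funpow_swap1)
qed simp

section \<open>A bump function\<close>

text \<open>The factor \<open>poly p (1/x)\<close> makes this family closed under differentiation.\<close>

definition exp_cutoff :: "real poly \<Rightarrow> real \<Rightarrow> real" where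
  "exp_cutoff p x = (if x > 0 then poly p (1 / x) * exp (- (1 / x)) else 0)"

lemma tendsto_poly_times_exp_neg:
  fixes p :: "real poly"
  shows "((\<lambda>z. poly p z * exp (- z)) \<longlongrightarrow> 0) at_top"
proof -
  have "((\<lambda>z. \<Sum>i\<le>degree p. coeff p i * (z ^ i / exp z)) \<longlongrightarrow> (\<Sum>i\<le>degree p. coeff p i * 0)) at_top"
    by (intro tendsto_intros tendsto_power_div_exp_0)
  then show ?thesis
    by (simp add: poly_altdef sum_distrib_right exp_minus divide_inverse mult.assoc)
qed

text \<open>With \<open>z = 1 / x\<close> one has \<open>dz/dx = - z^2\<close>, so the derivative of
  \<open>p(z) exp(-z)\<close> is \<open>z^2 (p - p')(z) exp(-z)\<close>; \<open>[:0, 0, 1:]\<close>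
  is the polynomial \<open>z^2\<close>.\<close>

lemma exp_cutoff_has_derivative:
  "(exp_cutoff p has_real_derivative exp_cutoff ([:0, 0, 1:] * (p - pderiv p)) x) (at x)"
proof (cases x "0::real" rule: linorder_cases)
  case less
  have "((\<lambda>x. 0) has_real_derivative 0) (at x)"
    by simp
  then have "(exp_cutoff p has_real_derivative 0) (at x)"
    by (rule has_field_derivative_transform_within_open[where S = "{..<0}"])
      (use less in \<open>auto simp: exp_cutoff_def\<close>)
  then show ?thesis
    using less by (simp add: exp_cutoff_def)
next
  case equal
  have "((\<lambda>h. exp_cutoff p h / h) \<longlongrightarrow> 0) (at_right 0)"
  proof -
    \<comment> \<open>With \<open>z = 1 / h\<close> the difference quotient at 0 is
      \<open>z p(z) exp(-z)\<close>, again a polynomial times \<open>exp(-z)\<close>.\<close>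
    have "((\<lambda>h. poly ([:0, 1:] * p) (inverse h) * exp (- inverse h)) \<longlongrightarrow> 0) (at_right 0)"
      by (rule filterlim_compose[OF tendsto_poly_times_exp_neg filterlim_inverse_at_top_right])
    then show ?thesis
      by (rule Lim_transform_eventually)
        (auto simp: exp_cutoff_def eventually_at_filter field_simps)
  qed
  moreover have "((\<lambda>h. exp_cutoff p h / h) \<longlongrightarrow> 0) (at_left 0)"
    by (rule Lim_transform_eventually[OF tendsto_const])
      (auto simp: exp_cutoff_def eventually_at_filter)
  ultimately have "((\<lambda>h. exp_cutoff p h / h) \<longlongrightarrow> 0) (at 0)"
    by (simp add: filterlim_at_split)
  then show ?thesis
    using equal by (simp add: DERIV_def exp_cutoff_def)
next
  case greater
  have "((\<lambda>x. poly p (1 / x) * exp (- (1 / x))) has_real_derivative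
      poly ([:0, 0, 1:] * (p - pderiv p)) (1 / x) * exp (- (1 / x))) (at x)"
    using greater by (auto intro!: derivative_eq_intros DERIV_chain2[OF poly_DERIV]
        simp: field_simps power2_eq_square)
  then have "(exp_cutoff p has_real_derivative
      poly ([:0, 0, 1:] * (p - pderiv p)) (1 / x) * exp (- (1 / x))) (at x)"
    by (rule has_field_derivative_transform_within_open[where S = "{0<..}"])
      (use greater in \<open>auto simp: exp_cutoff_def\<close>)
  then show ?thesis
    using greater by (simp add: exp_cutoff_def)
qed

lemma times_differentiable_exp_cutoff: "times_differentiable k (exp_cutoff p)"
proof (induction k arbitrary: p)
  case (Suc k)
  have "deriv (exp_cutoff p) = exp_cutoff ([:0, 0, 1:] * (p - pderiv p))"
    by (intro ext DERIV_imp_deriv exp_cutoff_has_derivative)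
  then show ?case
    using Suc exp_cutoff_has_derivative real_differentiable_def
    unfolding times_differentiable_Suc by metis
qed (simp add: times_differentiable_0)

lemma ex_test_function_integral_nonzero:
  obtains \<phi> where "test_function \<phi>" "integral UNIV \<phi> \<noteq> 0"
proof
  \<comment> \<open>For \<open>\<bar>x\<bar> < 1\<close> this is
    \<open>exp(-1/(1+x)) exp(-1/(1-x))\<close>, and 0 elsewhere. The arguments are spelled out in
    affine form to fit the composition lemma.\<close>
  define \<phi> where "\<phi> x = exp_cutoff 1 (1 * x + 1) * exp_cutoff 1 ((-1) * x + 1)" for x
  have zero: "\<phi> x = 0" if "1 < \<bar>x\<bar>" for x
    using that by (auto simp: \<phi>_def exp_cutoff_def)
  have "times_differentiable k \<phi>" for k
    unfolding \<phi>_def by (intro times_differentiable_mult times_differentiable_compose_affine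
        times_differentiable_exp_cutoff)
  with zero show test: "test_function \<phi>"
    by (auto simp: test_function_iff)
  have "integral {-1..1} \<phi> \<noteq> 0"
  proof
    assume "integral {-1..1} \<phi> = 0"
    moreover have "\<phi> x \<ge> 0" for x
      by (simp add: \<phi>_def exp_cutoff_def)
    \<comment> \<open>A continuous nonnegative function with zero integral vanishes, but the value
      at 0 is \<open>exp(-2)\<close>.\<close>
    ultimately have "\<forall>x\<in>{-1..1}. \<phi> x = 0"
      using integral_eq_0_iff[of "-1" 1 \<phi>] test_function_continuous_on[OF test] by simp
    then have "\<phi> 0 = 0"
      by simp
    then show False
      by (simp add: \<phi>_def exp_cutoff_def)
  qed
  moreover have "(\<lambda>x. if x \<in> {-1..1} then \<phi> x else 0) = \<phi>"
    using zero by (force simp: fun_eq_iff)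
  then have "integral UNIV \<phi> = integral {-1..1} \<phi>"
    using integral_restrict_UNIV[of "{-1..1}" \<phi>] by simp
  ultimately show "integral UNIV \<phi> \<noteq> 0"
    by simp
qed

section \<open>Self-similarity\<close>

text \<open>The integrand involves only \<open>x * w\<close> and \<open>t * w ^ n\<close>; with
  \<open>w = s * v\<close> these become \<open>(s * x) * v\<close> and \<open>v ^ n\<close>,
  whatever the parity of \<open>n\<close>.\<close>

lemma fourier_integrand_scale:
  assumes "t * s ^ n = 1"
  shows "fourier_integrand n a t x (s * v) = fourier_integrand n a 1 (s * x) v"
proof -
  have "t * (s * v) ^ n = v ^ n"
    using assms by (simp add: power_mult_distrib flip: mult.assoc)
  then have "(-1) ^ (n div 2) * a * t * (s * v) ^ n = (-1) ^ (n div 2) * a * 1 * v ^ n"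
    by simp
  then show ?thesis
    unfolding fourier_integrand_def by (simp only: mult.assoc mult.left_commute[of x s])
qed

lemma integral_fourier_integrand_scale:
  assumes "t * s ^ n = 1" "s > 0"
  shows "integral {0..s * R} (fourier_integrand n a t x) =
         s * integral {0..R} (fourier_integrand n a 1 (s * x))"
proof (cases "R \<ge> 0")
  case True
  have "continuous_on {0..s * R} (fourier_integrand n a t x)"
    by (cases "odd n") (auto simp: fourier_integrand_def intro!: continuous_intros)
  then have "(fourier_integrand n a t x has_integral
      integral {0..s * R} (fourier_integrand n a t x)) {0..s * R}"
    by (intro integrable_integral integrable_continuous_interval)
  from has_integral_stretch_real[OF this, of s] \<open>s > 0\<close> True
  have "((\<lambda>v. fourier_integrand n a t x (s * v)) has_integral
      (1 / s) * integral {0..s * R} (fourier_integrand n a t x)) {0..R}"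
    by (simp add: image_divide_atLeastAtMost)
  then have "integral {0..R} (fourier_integrand n a 1 (s * x)) =
      (1 / s) * integral {0..s * R} (fourier_integrand n a t x)"
    by (simp add: fourier_integrand_scale[OF assms(1)] integral_unique)
  then show ?thesis
    using \<open>s > 0\<close> by simp
next
  \<comment> \<open>Negative \<open>R\<close> gives empty intervals; including it makes the two
    sides equal as functions of \<open>R\<close>.\<close>
  case False
  then have "{0..R} = {}" "{0..s * R} = {}"
    using \<open>s > 0\<close> by (auto simp: mult_less_0_iff)
  then show ?thesis
    by simp
qed

text \<open>Since \<open>s > 0\<close>, the cutoff \<open>s * R\<close> also tends to infinity, so
  both sides are limits of the same function of \<open>R\<close>.\<close>

lemma obtained_by_fourier_transform_scale:
  assumes "obtained_by_fourier_transform n a u" "t > 0" "t * s ^ n = 1" "s > 0"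
  shows "u t x = s * u 1 (s * x)"
proof -
  have "((\<lambda>R. 1 / pi * integral {0..R} (fourier_integrand n a t x)) \<longlongrightarrow> u t x) at_top"
    using assms by (simp add: obtained_by_fourier_transform_def)
  moreover have "filterlim (\<lambda>R. s * R) at_top at_top"
    using \<open>s > 0\<close> by (intro filterlim_tendsto_pos_mult_at_top[OF tendsto_const] filterlim_ident)
  ultimately have lim:
    "((\<lambda>R. 1 / pi * integral {0..s * R} (fourier_integrand n a t x)) \<longlongrightarrow> u t x) at_top"
    by (rule filterlim_compose)
  moreover have
    "((\<lambda>R. s * (1 / pi * integral {0..R} (fourier_integrand n a 1 (s * x)))) \<longlongrightarrow>
        s * u 1 (s * x)) at_top"
    using assms by (intro tendsto_mult_left) (simp add: obtained_by_fourier_transform_def)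
  moreover have "(\<lambda>R. s * (1 / pi * integral {0..R} (fourier_integrand n a 1 (s * x)))) =
      (\<lambda>R. 1 / pi * integral {0..s * R} (fourier_integrand n a t x))"
    using integral_fourier_integrand_scale[OF assms(3,4)] by (simp add: fun_eq_iff)
  ultimately have "((\<lambda>R. 1 / pi * integral {0..s * R} (fourier_integrand n a t x)) \<longlongrightarrow>
      s * u 1 (s * x)) at_top"
    by simp
  with lim show ?thesis
    by (rule tendsto_unique[OF trivial_limit_at_top_linorder])
qed

text \<open>The positive solution \<open>s\<close> of \<open>t * s ^ n = 1\<close>, in a closed form
  that can be differentiated in \<open>t\<close>.\<close>

definition similarity_scale :: "nat \<Rightarrow> real \<Rightarrow> real" where
  "similarity_scale n t = t powr (- 1 / real n)"

lemma similarity_scale_pos: "t > 0 \<Longrightarrow> similarity_scale n t > 0"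
  by (simp add: similarity_scale_def)

lemma similarity_scale_power:
  assumes "t > 0" "n > 0"
  shows "t * similarity_scale n t ^ n = 1"
proof -
  have "similarity_scale n t ^ n = similarity_scale n t powr real n"
    using similarity_scale_pos[OF assms(1)] by (simp add: powr_realpow)
  also have "\<dots> = t powr (-1)"
    using assms by (simp add: similarity_scale_def powr_powr)
  finally show ?thesis
    using assms by (simp add: powr_minus)
qed

lemma similarity_scale_DERIV:
  assumes "t > 0" "n > 0"
  shows "(similarity_scale n has_real_derivative - similarity_scale n t / (real n * t)) (at t)"
proof -
  have "((\<lambda>t. t powr (- 1 / real n)) has_real_derivative
      - 1 / real n * t powr (- 1 / real n - 1)) (at t)"
    using assms(1) by (rule has_real_derivative_powr)
  moreover have "t powr (- 1 / real n - 1) = t powr (- 1 / real n) / t"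
    using powr_diff[of t "- 1 / real n" 1] assms(1) by simp
  ultimately show ?thesis
    by (simp add: similarity_scale_def[abs_def] mult.commute)
qed

text \<open>Chain rule for \<open>s * u 1 (s * x)\<close> with \<open>s' = - s / (n t)\<close>. The
  numerator is the \<open>x\<close>-derivative of \<open>x * u t x\<close>, which makes the equation
  integrable once in \<open>x\<close>.\<close>

lemma self_similar_time_derivative:
  fixes u :: "real \<Rightarrow> real \<Rightarrow> real"
  assumes "n > 0" "t > 0"
    and scale: "\<And>t x. t > 0 \<Longrightarrow> u t x = similarity_scale n t * u 1 (similarity_scale n t * x)"
    and diff: "\<And>x. u 1 differentiable (at x)"
  shows "((\<lambda>r. u r x) has_real_derivative - (u t x + x * deriv (u t) x) / (real n * t)) (at t)"
proof -
  let ?s = "similarity_scale n t" and ?s' = "- similarity_scale n t / (real n * t)"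
  let ?g = "u 1"
  have dg: "(?g has_real_derivative deriv ?g y) (at y)" for y
    using diff by (rule differentiable_imp_DERIV_deriv)
  have ds: "(similarity_scale n has_real_derivative ?s') (at t)"
    using assms by (intro similarity_scale_DERIV)
  have "((\<lambda>r. ?g (similarity_scale n r * x)) has_real_derivative deriv ?g (?s * x) * (?s' * x)) (at t)"
    by (rule DERIV_chain2[OF dg]) (rule DERIV_cmult_right[OF ds])
  from DERIV_mult[OF ds this]
  have "((\<lambda>r. similarity_scale n r * ?g (similarity_scale n r * x)) has_real_derivative
      ?s' * ?g (?s * x) + deriv ?g (?s * x) * (?s' * x) * ?s) (at t)" .
  then have "((\<lambda>r. u r x) has_real_derivative
      ?s' * ?g (?s * x) + deriv ?g (?s * x) * (?s' * x) * ?s) (at t)"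
    \<comment> \<open>The scaling law holds for positive times only, an open set containing
      \<open>t\<close>.\<close>
    by (rule has_field_derivative_transform_within_open[where S = "{0<..}"])
      (use \<open>t > 0\<close> in \<open>auto simp: scale[symmetric]\<close>)
  moreover have "deriv (u t) x = ?s * (?s * deriv ?g (?s * x))"
  proof (rule DERIV_imp_deriv)
    have "((\<lambda>x. ?s * ?g (?s * x + 0)) has_real_derivative ?s * (?s * deriv ?g (?s * x + 0))) (at x)"
      by (intro DERIV_cmult DERIV_compose_affine dg)
    moreover have "u t = (\<lambda>x. ?s * ?g (?s * x))"
      using scale \<open>t > 0\<close> by blast
    ultimately show "(u t has_real_derivative ?s * (?s * deriv ?g (?s * x))) (at x)"
      by simp
  qed
  then have "?s' * ?g (?s * x) + deriv ?g (?s * x) * (?s' * x) * ?s =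
      - (u t x + x * deriv (u t) x) / (real n * t)"
    using assms(1,2) by (simp add: scale[OF \<open>t > 0\<close>, of x] field_simps)
  ultimately show ?thesis
    by simp
qed

section \<open>The Airy-type equation\<close>

lemma airy_equation_up_to_constant:
  fixes u :: "real \<Rightarrow> real \<Rightarrow> real"
  assumes "n > 0" "a \<noteq> 0" "t > 0"
    and u: "heat_type_problem n a u"
    and scale: "\<And>t x. t > 0 \<Longrightarrow> u t x = similarity_scale n t * u 1 (similarity_scale n t * x)"
  shows "(deriv ^^ (n - 1)) (u t) x + (1 / (real n * t * a)) * x * u t x =
         (deriv ^^ (n - 1)) (u 1) 0 / t"
proof -
  have td: "times_differentiable n (u r)" if "r > 0" for r
    using u that by (simp add: heat_type_problem_def)
  have diff: "u r differentiable (at y)" if "r > 0" for r y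
    using td[OF that] \<open>n > 0\<close> by (cases n) (auto simp: times_differentiable_Suc)
  define c where "c = 1 / (real n * t * a)"
  have "((\<lambda>x. (deriv ^^ (n - 1)) (u t) x + c * x * u t x) has_real_derivative 0) (at y)" for y
  proof -
    have "((\<lambda>r. u r y) has_real_derivative a * (deriv ^^ n) (u t) y) (at t)"
      using u \<open>t > 0\<close> by (simp add: heat_type_problem_def)
    moreover have "((\<lambda>r. u r y) has_real_derivative
        - (u t y + y * deriv (u t) y) / (real n * t)) (at t)"
      using \<open>n > 0\<close> \<open>t > 0\<close> scale diff[OF zero_less_one]
      by (rule self_similar_time_derivative)
    ultimately have "a * (deriv ^^ n) (u t) y = - (u t y + y * deriv (u t) y) / (real n * t)"
      by (rule DERIV_unique)
    \<comment> \<open>Division by \<open>a\<close> produces exactly \<open>c = 1 / (n t a)\<close>;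
      the left side is the derivative of the Airy expression.\<close>
    then have eq: "(deriv ^^ n) (u t) y + c * (u t y + y * deriv (u t) y) = 0"
      using assms(1-3) by (simp add: c_def field_simps)
    have "((deriv ^^ (n - 1)) (u t) has_real_derivative (deriv ^^ n) (u t) y) (at y)"
      using times_differentiable_has_derivative[OF td[OF \<open>t > 0\<close>], of "n - 1" y] \<open>n > 0\<close> by simp
    moreover have "(u t has_real_derivative deriv (u t) y) (at y)"
      using diff \<open>t > 0\<close> by (intro differentiable_imp_DERIV_deriv)
    ultimately have "((\<lambda>x. (deriv ^^ (n - 1)) (u t) x + c * x * u t x) has_real_derivative
        (deriv ^^ n) (u t) y + c * (u t y + y * deriv (u t) y)) (at y)"
      by (auto intro!: derivative_eq_intros simp: algebra_simps)
    then show ?thesis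
      by (simp only: eq)
  qed
  \<comment> \<open>The constant value is read off at 0, where the term with factor \<open>x\<close>
    drops out.\<close>
  then have "(deriv ^^ (n - 1)) (u t) x + c * x * u t x =
      (deriv ^^ (n - 1)) (u t) 0 + c * 0 * u t 0"
    by (intro DERIV_isconst_all) blast
  also have "\<dots> = (deriv ^^ (n - 1)) (u t) 0"
    by simp
  also have "\<dots> = similarity_scale n t ^ n * (deriv ^^ (n - 1)) (u 1) 0"
  proof -
    have "u t = (\<lambda>x. similarity_scale n t * u 1 (similarity_scale n t * x))"
      using scale \<open>t > 0\<close> by blast
    then have "(deriv ^^ (n - 1)) (u t) =
        (deriv ^^ (n - 1)) (\<lambda>x. similarity_scale n t * u 1 (similarity_scale n t * x))"
      by (rule arg_cong)
    also have "\<dots> = (\<lambda>x. similarity_scale n t ^ Suc (n - 1) *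
        (deriv ^^ (n - 1)) (u 1) (similarity_scale n t * x))"
      by (rule higher_deriv_scale[OF td]) auto
    finally show ?thesis
      using \<open>n > 0\<close> by simp
  qed
  also have "similarity_scale n t ^ n = 1 / t"
    using similarity_scale_power[of t n] assms(1,3) by (simp add: field_simps)
  finally show ?thesis
    by (simp add: c_def)
qed

text \<open>\<open>K\<close> is the same for all \<open>t\<close>, so it can be found in the limit
  \<open>t --> 0\<close>, where the initial datum is known weakly.\<close>

lemma airy_constant_eq_0:
  fixes u :: "real \<Rightarrow> real \<Rightarrow> real"
  assumes "n > 0" "a \<noteq> 0"
    and u: "heat_type_problem n a u"
    and eq: "\<And>t x. t > 0 \<Longrightarrow>
      (deriv ^^ (n - 1)) (u t) x + (1 / (real n * t * a)) * x * u t x = K / t"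
  shows "K = 0"
proof -
  obtain \<phi> where \<phi>: "test_function \<phi>" and nz: "integral UNIV \<phi> \<noteq> 0"
    by (rule ex_test_function_integral_nonzero)
  define I where "I \<psi> t = integral UNIV (\<lambda>x. u t x * \<psi> x)" for \<psi> t
  have lim: "(I \<psi> \<longlongrightarrow> \<psi> 0) (at_right 0)" if "test_function \<psi>" for \<psi>
    using u that unfolding heat_type_problem_def I_def by blast
  \<comment> \<open>Multiplying by \<open>t\<close> clears the \<open>1 / t\<close> in both
    \<open>K / t\<close> and the coefficient of \<open>x * u t x\<close>. With all derivatives on
    \<open>\<phi>\<close>, only pairings of \<open>u t\<close> with fixed test functions
    remain.\<close>
  have "t * ((-1) ^ (n - 1) * I ((deriv ^^ (n - 1)) \<phi>) t) +
      1 / (real n * a) * I (\<lambda>x. x * \<phi> x) t = K * integral UNIV \<phi>" if "t > 0" for t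
  proof -
    have td: "times_differentiable n (u t)"
      using u that by (simp add: heat_type_problem_def)
    have int1: "(\<lambda>x. (deriv ^^ (n - 1)) (u t) x * \<phi> x) integrable_on UNIV"
      using td \<open>n > 0\<close>
      by (intro integrable_times_test_function \<phi> times_differentiable_continuous_on) auto
    have int2: "(\<lambda>x. u t x * (x * \<phi> x)) integrable_on UNIV"
      using times_differentiable_continuous_on[OF td, of 0] \<open>n > 0\<close>
      by (intro integrable_times_test_function test_function_times_ident \<phi>) auto
    have "K * integral UNIV \<phi> = integral UNIV (\<lambda>x. K * \<phi> x)"
      by simp
    also have "(\<lambda>x. K * \<phi> x) = (\<lambda>x. t * ((deriv ^^ (n - 1)) (u t) x * \<phi> x) +
        1 / (real n * a) * (u t x * (x * \<phi> x)))"
    proof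
      fix x
      have "K = t * ((deriv ^^ (n - 1)) (u t) x + (1 / (real n * t * a)) * x * u t x)"
        using eq[OF that, of x] that by simp
      also have "\<dots> = t * (deriv ^^ (n - 1)) (u t) x + 1 / (real n * a) * (x * u t x)"
        using that assms(1,2) by (simp add: field_simps)
      finally have "K * \<phi> x =
          (t * (deriv ^^ (n - 1)) (u t) x + 1 / (real n * a) * (x * u t x)) * \<phi> x"
        by simp
      then show "K * \<phi> x = t * ((deriv ^^ (n - 1)) (u t) x * \<phi> x) +
          1 / (real n * a) * (u t x * (x * \<phi> x))"
        by (simp only: ring_distribs ac_simps)
    qed
    also have "integral UNIV \<dots> = t * integral UNIV (\<lambda>x. (deriv ^^ (n - 1)) (u t) x * \<phi> x) +
        1 / (real n * a) * I (\<lambda>x. x * \<phi> x) t"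
      using integral_add[OF integrable_on_mult_right[OF int1, of t]
          integrable_on_mult_right[OF int2, of "1 / (real n * a)"]]
      by (simp only: I_def integral_mult_right)
    also have "integral UNIV (\<lambda>x. (deriv ^^ (n - 1)) (u t) x * \<phi> x) =
        (-1) ^ (n - 1) * I ((deriv ^^ (n - 1)) \<phi>) t"
      unfolding I_def using td \<phi> \<open>n > 0\<close>
      by (intro integral_higher_deriv_test_function) auto
    finally show ?thesis ..
  qed
  then have "\<forall>\<^sub>F t in at_right 0. t * ((-1) ^ (n - 1) * I ((deriv ^^ (n - 1)) \<phi>) t) +
      1 / (real n * a) * I (\<lambda>x. x * \<phi> x) t = K * integral UNIV \<phi>"
    by (simp add: eventually_at_filter)
  \<comment> \<open>The first pairing converges and is multiplied by \<open>t\<close>; the second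
    tends to the value of \<open>x * \<phi> x\<close> at 0. Both terms vanish in the limit.\<close>
  moreover have "((\<lambda>t. t * ((-1) ^ (n - 1) * I ((deriv ^^ (n - 1)) \<phi>) t) +
      1 / (real n * a) * I (\<lambda>x. x * \<phi> x) t) \<longlongrightarrow>
      0 * ((-1) ^ (n - 1) * (deriv ^^ (n - 1)) \<phi> 0) + 1 / (real n * a) * (0 * \<phi> 0)) (at_right 0)"
    using lim[OF test_function_funpow_deriv[OF \<phi>]] lim[OF test_function_times_ident[OF \<phi>]]
    by (intro tendsto_intros)
  ultimately have "((\<lambda>t. K * integral UNIV \<phi>) \<longlongrightarrow>
      0 * ((-1) ^ (n - 1) * (deriv ^^ (n - 1)) \<phi> 0) + 1 / (real n * a) * (0 * \<phi> 0))
      (at_right (0::real))"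
    by (rule Lim_transform_eventually[rotated])
  then have "K * integral UNIV \<phi> = 0"
    by (simp add: tendsto_const_iff)
  with nz show ?thesis
    by simp
qed

theorem proposition3p1:
  fixes n :: nat and a :: real and u :: "real \<Rightarrow> real \<Rightarrow> real"
  assumes "n \<ge> 2" and "a \<noteq> 0"
    and "even n \<Longrightarrow> (-1) ^ (n div 2) * a < 0"
    and "heat_type_problem n a u"
    and "obtained_by_fourier_transform n a u"
  shows "\<forall>t>0. times_differentiable (n - 1) (u t) \<and>
           (\<forall>x. (deriv ^^ (n - 1)) (u t) x + (1 / (real n * t * a)) * x * u t x = 0)"
proof -
  have "n > 0"
    using assms(1) by simp
  have scale: "u t x = similarity_scale n t * u 1 (similarity_scale n t * x)" if "t > 0" for t x
    using assms(5) that similarity_scale_power[OF that \<open>n > 0\<close>] similarity_scale_pos[OF that]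
    by (rule obtained_by_fourier_transform_scale)
  have eq: "(deriv ^^ (n - 1)) (u t) x + (1 / (real n * t * a)) * x * u t x =
      (deriv ^^ (n - 1)) (u 1) 0 / t" if "t > 0" for t x
    using \<open>n > 0\<close> assms(2) that assms(4) scale by (rule airy_equation_up_to_constant)
  \<comment> \<open>This derivative plays the role of \<open>K\<close>: it involves neither
    \<open>t\<close> nor \<open>x\<close>.\<close>
  have "(deriv ^^ (n - 1)) (u 1) 0 = 0"
    using \<open>n > 0\<close> assms(2,4) eq by (rule airy_constant_eq_0)
  moreover have "times_differentiable (n - 1) (u t)" if "t > 0" for t
    using assms(4) that times_differentiable_mono[of n "u t" "n - 1"]
    by (simp add: heat_type_problem_def)
  ultimately show ?thesis
    using eq by simp
qed

end
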